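(* Let $n,m,k$ be integers with $m\ge 1$ and $1\le k<n$, and let $(p_{ij})\in\{0,1\}^{n\times m}$ be a matrix of voters' preference profiles. For $S\subset\{1,\dots,n\}$ with $|S|=k$ let $\gamma_j(S)=\sum_{i\in S}p_{ij}$. Then the program, in the variables $v\in\mathbb{R}$ and $x\in\{0,1\}^m$, $$\begin{aligned}\min\ & v\\ \text{s.t. } & \sum_{j=1}^m (k-\gamma_j(S))x_j+\sum_{j=1}^m\gamma_j(S)(1-x_j)\le v && \text{for all } S\subset\{1,\dots,n\},\ |S|=k,\\ & x\in\{0,1\}^m\end{aligned}$$ is a valid formulation of the $k$-sum approval voting problem; that is, its optimal value equals the optimal value of the $k$-sum approval voting problem, and a committee $x\in\{0,1\}^m$ is optimal for the $k$-sum approval voting problem if and only if $x$ is the $x$-part of some optimal solution of the program.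
   Context: There are $n$ voters and $m$ candidates. The preference profile of voter $i$ is the vector $P_i=(p_{i1},\dots,p_{im})\in\{0,1\}^m$, with $p_{ij}=1$ if and only if voter $i$ approves candidate $j$. A committee is a vector $x\in\{0,1\}^m$ (no constraint on its size). The Hamming distance of voter $i$ to $x$ is $d_i(x)=\sum_{j=1}^m|p_{ij}-x_j|$. The $k$-sum approval voting problem is to find $x\in\{0,1\}^m$ minimizing the sum of the $k$ largest among the $n$ numbers $d_1(x),\dots,d_n(x)$ (counted with multiplicity); its optimal value is this minimum. *)

theory Defs
  imports Complex_Main "HOL-Library.FuncSet"
begin

text \<open>
  Voters are \<open>1, \<dots>, n\<close> and candidates \<open>1, \<dots>, m\<close>. A vector in \<open>{0,1}\<close> to the power \<open>m\<close> is a
  real-valued function on \<open>{1..m}\<close>, made extensional so that equality of committees is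
  equality of functions.
\<close>

definition committees :: "nat \<Rightarrow> (nat \<Rightarrow> real) set" where
  "committees m = {1..m} \<rightarrow>\<^sub>E {0, 1}"

definition hamming :: "nat \<Rightarrow> (nat \<Rightarrow> nat \<Rightarrow> real) \<Rightarrow> (nat \<Rightarrow> real) \<Rightarrow> nat \<Rightarrow> real" where
  "hamming m p x i = (\<Sum>j = 1..m. \<bar>p i j - x j\<bar>)"

definition sum_largest :: "nat \<Rightarrow> real list \<Rightarrow> real" where
  "sum_largest k ds = sum_list (take k (rev (sort ds)))"

definition ksum_objective ::
    "nat \<Rightarrow> nat \<Rightarrow> nat \<Rightarrow> (nat \<Rightarrow> nat \<Rightarrow> real) \<Rightarrow> (nat \<Rightarrow> real) \<Rightarrow> real" where
  "ksum_objective n m k p x = sum_largest k (map (hamming m p x) [1..<Suc n])"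

definition approval_count :: "(nat \<Rightarrow> nat \<Rightarrow> real) \<Rightarrow> nat set \<Rightarrow> nat \<Rightarrow> real" where
  "approval_count p S j = (\<Sum>i\<in>S. p i j)"

definition program_feasible ::
    "nat \<Rightarrow> nat \<Rightarrow> nat \<Rightarrow> (nat \<Rightarrow> nat \<Rightarrow> real) \<Rightarrow> real \<times> (nat \<Rightarrow> real) \<Rightarrow> bool" where
  "program_feasible n m k p = (\<lambda>(v, x).
     x \<in> committees m \<and>
     (\<forall>S. S \<subseteq> {1..n} \<and> card S = k \<longrightarrow>
        (\<Sum>j = 1..m. (real k - approval_count p S j) * x j)
          + (\<Sum>j = 1..m. approval_count p S j * (1 - x j)) \<le> v))"

text \<open>
  The minimum of \<open>f\<close> over the points satisfying \<open>P\<close> is attained and equals \<open>c\<close>.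
\<close>

definition is_optimal_value :: "('a \<Rightarrow> real) \<Rightarrow> ('a \<Rightarrow> bool) \<Rightarrow> real \<Rightarrow> bool" where
  "is_optimal_value f P c \<longleftrightarrow> (\<exists>z. is_arg_min f P z \<and> f z = c)"

end

theory Submission
  imports Defs "HOL-Library.Multiset"
begin

text \<open>
  For 0/1 data, the left-hand side of the constraint indexed by \<open>S\<close> is the total Hamming distance
  \<open>\<Sum>i\<in>S. d\<^sub>i(x)\<close>, and the sum of the \<open>k\<close> largest distances is the maximum of these totals over
  all \<open>S\<close> of size \<open>k\<close>. Hence the program minimises over the epigraph of the \<open>k\<close>-sum objective.
\<close>

text \<open>Exchange argument: every entry of the tail has a value at most that of any entry among
  the first \<open>k\<close>, so swapping elements of \<open>S\<close> for elements of
  \<open>T\<close> never lowers the sum. Quantifying over a bound \<open>c\<close> expresses a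
  maximum over subsets in the shape of the program's constraints.\<close>

lemma sum_list_le_iff_distinct_subsets:
  fixes f :: "'a \<Rightarrow> real"
  assumes "distinct ys" and "sorted_wrt (\<lambda>a b. f b \<le> f a) ys" and "k \<le> length ys"
  shows "sum_list (map f (take k ys)) \<le> c \<longleftrightarrow>
    (\<forall>S. S \<subseteq> set ys \<and> card S = k \<longrightarrow> sum f S \<le> c)"
proof -
  define T where "T = set (take k ys)"
  have sorted: "sorted_wrt (\<lambda>a b. f b \<le> f a) (take k ys @ drop k ys)"
    and ys: "set ys = T \<union> set (drop k ys)"
    using assms(2) unfolding T_def by (simp_all flip: set_append)
  have T: "T \<subseteq> set ys" "card T = k" "finite T"
    using assms distinct_card[of "take k ys"] by (auto simp: T_def set_take_subset)
  have sumT: "sum_list (map f (take k ys)) = sum f T"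
    unfolding T_def using assms(1) by (simp add: sum_list_distinct_conv_sum_set)
  have exchange: "sum f S \<le> sum f T" if S: "S \<subseteq> set ys" "card S = k" for S
  proof -
    have fin: "finite S" using S(1) finite_subset by blast
    \<comment> \<open>Both sets have size \<open>k\<close>, so what \<open>S\<close> has outside
      \<open>T\<close> can be matched with what it misses; the common part
      \<open>S \<inter> T\<close> cancels.\<close>
    have "card (S - T) = card (T - S)"
      using fin T S(2) by (simp add: card_Diff_subset_Int Int_commute)
    then obtain h where h: "bij_betw h (S - T) (T - S)"
      using fin T(3) finite_same_card_bij by blast
    have "f b \<le> f (h b)" if "b \<in> S - T" for b
    proof -
      have "b \<in> set (drop k ys)" using that S(1) ys by blast
      moreover have "h b \<in> set (take k ys)"
        using bij_betwE[OF h] that T_def by blast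
      ultimately show ?thesis using sorted by (auto simp only: sorted_wrt_append)
    qed
    then have "sum f (S - T) \<le> (\<Sum>b\<in>S - T. f (h b))" by (rule sum_mono)
    also have "\<dots> = sum f (T - S)" by (rule sum.reindex_bij_betw[OF h])
    finally show ?thesis
      using sum.Int_Diff[OF fin, of f T] sum.Int_Diff[OF T(3), of f S] by (simp add: Int_commute)
  qed
  \<comment> \<open>\<open>T\<close> is itself one of the subsets \<open>S\<close>, which settles
    the direction from right to left.\<close>
  show ?thesis unfolding sumT using T exchange order_trans by blast
qed

lemma sum_largest_le_iff:
  assumes "distinct xs" and "k \<le> length xs"
  shows "sum_largest k (map f xs) \<le> c \<longleftrightarrow>
    (\<forall>S. S \<subseteq> set xs \<and> card S = k \<longrightarrow> sum f S \<le> c)"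
proof -
  \<comment> \<open>Sorting indices instead of values keeps equal distances of different voters
    apart, so multiplicity is respected. Ties are harmless: a sorted list of values is determined by
    its multiset.\<close>
  define ys where "ys = rev (sort_key f xs)"
  have "sort (map f xs) = map f (sort_key f xs)"
    by (rule properties_for_sort) auto
  then have "sum_largest k (map f xs) = sum_list (map f (take k ys))"
    by (simp add: sum_largest_def ys_def rev_map take_map)
  moreover have "sorted_wrt (\<lambda>a b. f b \<le> f a) ys"
    using sorted_sort_key[of f xs] by (simp add: ys_def sorted_wrt_rev sorted_wrt_map)
  ultimately show ?thesis
    using sum_list_le_iff_distinct_subsets[of ys f k c] assms by (simp add: ys_def)
qed

lemma sum_hamming:
  assumes "\<forall>i\<in>S. \<forall>j\<in>{1..m}. p i j \<in> {0, 1}" and "x \<in> committees m"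
  shows "(\<Sum>i\<in>S. hamming m p x i) =
    (\<Sum>j = 1..m. (real (card S) - approval_count p S j) * x j)
      + (\<Sum>j = 1..m. approval_count p S j * (1 - x j))"
proof -
  \<comment> \<open>On bits the absolute value is affine in \<open>p i j\<close> for fixed
    \<open>x j\<close>, so summing over \<open>S\<close> leaves only the counts
    \<open>approval_count p S j\<close>.\<close>
  have "\<bar>p i j - x j\<bar> = (1 - p i j) * x j + p i j * (1 - x j)"
    if "i \<in> S" "j \<in> {1..m}" for i j
  proof -
    have "p i j \<in> {0, 1}" "x j \<in> {0, 1}"
      using assms that by (auto simp: committees_def PiE_iff)
    then show ?thesis by auto
  qed
  then have "(\<Sum>i\<in>S. hamming m p x i)
      = (\<Sum>i\<in>S. \<Sum>j = 1..m. (1 - p i j) * x j + p i j * (1 - x j))"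
    unfolding hamming_def by (intro sum.cong refl) blast
  also have "\<dots> = (\<Sum>j = 1..m. \<Sum>i\<in>S. (1 - p i j) * x j + p i j * (1 - x j))"
    by (rule sum.swap)
  also have "\<dots> = (\<Sum>j = 1..m. (real (card S) - approval_count p S j) * x j
      + approval_count p S j * (1 - x j))"
    by (simp add: approval_count_def sum.distrib sum_subtractf flip: sum_distrib_right)
  finally show ?thesis by (simp add: sum.distrib)
qed

lemma program_feasible_iff:
  assumes "k \<le> n" and "\<forall>i\<in>{1..n}. \<forall>j\<in>{1..m}. p i j \<in> {0, 1}"
  shows "program_feasible n m k p (v, x) \<longleftrightarrow> x \<in> committees m \<and> ksum_objective n m k p x \<le> v"
proof (cases "x \<in> committees m")
  case True
  have "(\<Sum>j = 1..m. (real k - approval_count p S j) * x j)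
      + (\<Sum>j = 1..m. approval_count p S j * (1 - x j)) = (\<Sum>i\<in>S. hamming m p x i)"
    if "S \<subseteq> {1..n}" "card S = k" for S
  proof -
    have "\<forall>i\<in>S. \<forall>j\<in>{1..m}. p i j \<in> {0, 1}" using assms(2) that(1) by blast
    from sum_hamming[OF this True] show ?thesis using that(2) by simp
  qed
  moreover have "set [1..<Suc n] = {1..n}" by auto
  ultimately show ?thesis
    using True assms(1) sum_largest_le_iff[of "[1..<Suc n]" k "hamming m p x" v]
    by (auto simp: program_feasible_def ksum_objective_def simp del: upt_Suc)
qed (simp add: program_feasible_def)

text \<open>At a minimiser the bound \<open>v\<close> has no slack, since \<open>(f x, x)\<close> is
  feasible too. Working with minimisers yields both the equality of optimal values and the
  correspondence of optimal committees.\<close>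

lemma is_arg_min_epigraph:
  fixes f :: "'a \<Rightarrow> real"
  assumes "\<And>v x. Q (v, x) \<longleftrightarrow> P x \<and> f x \<le> v"
  shows "is_arg_min fst Q (v, x) \<longleftrightarrow> is_arg_min f P x \<and> v = f x"
proof
  assume min: "is_arg_min fst Q (v, x)"
  then have x: "P x" "f x \<le> v"
    using assms by (auto simp: is_arg_min_linorder)
  \<comment> \<open>Compare with the feasible point \<open>(f y, y)\<close>; the case
    \<open>y = x\<close> forces \<open>v = f x\<close>.\<close>
  have le: "v \<le> f y" if "P y" for y
    using min that assms[of "f y" y] by (auto simp: is_arg_min_linorder)
  show "is_arg_min f P x \<and> v = f x"
    using x le by (force simp: is_arg_min_linorder)
next
  assume "is_arg_min f P x \<and> v = f x"
  then show "is_arg_min fst Q (v, x)"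
    using assms by (force simp: is_arg_min_linorder)
qed

theorem theorem2:
  fixes n m k :: nat and p :: "nat \<Rightarrow> nat \<Rightarrow> real"
  assumes "m \<ge> 1" and "1 \<le> k" and "k < n"
    and "\<forall>i\<in>{1..n}. \<forall>j\<in>{1..m}. p i j \<in> {0, 1}"
  shows "(\<exists>c. is_optimal_value (ksum_objective n m k p) (\<lambda>x. x \<in> committees m) c
            \<and> is_optimal_value fst (program_feasible n m k p) c)
       \<and> (\<forall>x \<in> committees m.
            is_arg_min (ksum_objective n m k p) (\<lambda>x. x \<in> committees m) x
              \<longleftrightarrow> (\<exists>v. is_arg_min fst (program_feasible n m k p) (v, x)))"
proof -
  let ?f = "ksum_objective n m k p"
  have epi: "is_arg_min fst (program_feasible n m k p) (v, x) \<longleftrightarrow>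
      is_arg_min ?f (\<lambda>x. x \<in> committees m) x \<and> v = ?f x" for v x
    using assms(3,4) by (intro is_arg_min_epigraph program_feasible_iff) auto
  \<comment> \<open>Extensionality leaves only finitely many committees, so the minimum is
    attained.\<close>
  have "finite (committees m)" "committees m \<noteq> {}"
    by (auto simp: committees_def PiE_eq_empty_iff intro!: finite_PiE)
  then obtain x where x: "is_arg_min ?f (\<lambda>x. x \<in> committees m) x"
    using ex_is_arg_min_if_finite by blast
  then have "is_arg_min fst (program_feasible n m k p) (?f x, x)"
    by (simp add: epi)
  with x have "is_optimal_value ?f (\<lambda>x. x \<in> committees m) (?f x)"
      "is_optimal_value fst (program_feasible n m k p) (?f x)"
    unfolding is_optimal_value_def by (blast, metis fst_conv)
  then show ?thesis by (auto simp: epi)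
qed

end
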